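(* Let $n,k$ be integers with $3\le k\le n-1$, and let $\mathcal X\subset\mathbb R^2$ be an $n$-independent set with $|\mathcal X|=d(n,k-2)+2$. Then there can be at most $4$ linearly independent curves of degree less than or equal to $k$ passing through all the nodes of $\mathcal X$.
   Context: $\Pi_n$ denotes the space of all bivariate real polynomials of total degree $\le n$, and $N_n=\dim\Pi_n=\tfrac12(n+1)(n+2)$. For $k\le n$, $d(n,k):=N_n-N_{n-k}=\tfrac12k(2n+3-k)$; in particular $d(n,k-2)=(n+1)+n+\cdots+(n-k+4)$. A node set is a finite set of distinct points of the plane. A polynomial $p\in\Pi_n$ is a fundamental polynomial for $A\in\mathcal X$ if $p(A)=1$ and $p$ vanishes on $\mathcal X\setminus\{A\}$. The set $\mathcal X$ is $n$-independent if each of its nodes has a fundamental polynomial in $\Pi_n$. A (plane algebraic) curve is the zero set of a bivariate polynomial of degree $\ge1$; the same letter is used for the polynomial and the curve, the degree of the curve is that of the polynomial, and linear independence of curves means linear independence of the polynomials. A curve passes through a node if its polynomial vanishes there. *)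

theory Defs
  imports Complex_Main "HOL-Computational_Algebra.Polynomial"
begin

text \<open>
  A bivariate real polynomial is an element of \<open>\<real>[x][y]\<close>: \<open>coeff (coeff p j) i\<close> is the coefficient
  of \<open>x^i y^j\<close>. The library's \<open>degree\<close> of such a \<open>p\<close> is only its degree in \<open>y\<close>.
\<close>

definition eval2 :: "real poly poly \<Rightarrow> real \<times> real \<Rightarrow> real" where
  "eval2 p A = poly (poly p [:snd A:]) (fst A)"

definition total_degree :: "real poly poly \<Rightarrow> nat" where
  "total_degree p = (if p = 0 then 0 else Max {i + j |i j. coeff (coeff p j) i \<noteq> 0})"

definition scale2 :: "real \<Rightarrow> real poly poly \<Rightarrow> real poly poly" where
  "scale2 c p = smult [:c:] p"

global_interpretation poly2: vector_space scale2
  by unfold_locales (simp_all add: scale2_def smult_add_right smult_add_left[symmetric] mult.commute flip: one_pCons)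

definition Pi_space :: "nat \<Rightarrow> real poly poly set" where
  "Pi_space n = {p. total_degree p \<le> n}"

definition N_dim :: "nat \<Rightarrow> nat" where
  "N_dim n = poly2.dim (Pi_space n)"

definition d_dim :: "nat \<Rightarrow> nat \<Rightarrow> nat" where
  "d_dim n k = N_dim n - N_dim (n - k)"

definition fundamental_poly :: "nat \<Rightarrow> (real \<times> real) set \<Rightarrow> real \<times> real \<Rightarrow> real poly poly \<Rightarrow> bool" where
  "fundamental_poly n X A p \<longleftrightarrow> p \<in> Pi_space n \<and> eval2 p A = 1 \<and> (\<forall>B\<in>X - {A}. eval2 p B = 0)"

definition n_independent :: "nat \<Rightarrow> (real \<times> real) set \<Rightarrow> bool" where
  "n_independent n X \<longleftrightarrow> (\<forall>A\<in>X. \<exists>p. fundamental_poly n X A p)"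

text \<open>A curve is identified with its polynomial, so two proportional polynomials are two curves,
  and real curves may have an empty zero set.\<close>

definition is_curve :: "real poly poly \<Rightarrow> bool" where
  "is_curve p \<longleftrightarrow> total_degree p \<ge> 1"

definition passes_through :: "real poly poly \<Rightarrow> real \<times> real \<Rightarrow> bool" where
  "passes_through p A \<longleftrightarrow> eval2 p A = 0"

lemma eval2_eq_sum:
  "eval2 p (a, b) = (\<Sum>j\<le>degree p. \<Sum>i\<le>degree (coeff p j). coeff (coeff p j) i * a ^ i * b ^ j)"
proof -
  have "eval2 p (a, b) = poly (\<Sum>j\<le>degree p. coeff p j * [:b:] ^ j) a"
    by (simp only: eval2_def fst_conv snd_conv poly_altdef[of p])
  also have "\<dots> = (\<Sum>j\<le>degree p. poly (coeff p j) a * b ^ j)"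
    by (simp add: poly_sum poly_power)
  also have "\<dots> = (\<Sum>j\<le>degree p. \<Sum>i\<le>degree (coeff p j). coeff (coeff p j) i * a ^ i * b ^ j)"
    by (simp only: poly_altdef[where 'a = real] sum_distrib_right)
  finally show ?thesis .
qed

lemma finite_support2: "finite {(i, j). coeff (coeff p j) i \<noteq> (0::real)}"
proof (rule finite_subset)
  show "{(i, j). coeff (coeff p j) i \<noteq> 0} \<subseteq> (\<lambda>(j, i). (i, j)) ` (SIGMA j:{..degree p}. {..degree (coeff p j)})"
    by (force simp: image_iff intro: le_degree)
qed auto

lemma total_degree_le_iff:
  "total_degree p \<le> n \<longleftrightarrow> (\<forall>i j. coeff (coeff p j) i \<noteq> 0 \<longrightarrow> i + j \<le> n)"
proof (cases "p = 0")
  case False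
  let ?S = "{i + j |i j. coeff (coeff p j) i \<noteq> 0}"
  have "?S = (\<lambda>(i, j). i + j) ` {(i, j). coeff (coeff p j) i \<noteq> 0}" by force
  then have fin: "finite ?S" using finite_support2 by simp
  from False obtain j i where "coeff (coeff p j) i \<noteq> 0"
    by (metis leading_coeff_0_iff)
  then have "?S \<noteq> {}" by blast
  with False fin show ?thesis by (auto simp: total_degree_def)
qed (simp add: total_degree_def)

lemma dim_Pi_space_card: "N_dim n = card {(i, j). i + j \<le> n}"
proof -
  let ?I = "{(i, j). i + j \<le> n} :: (nat \<times> nat) set"
  let ?m = "\<lambda>(i, j). monom (monom (1::real) i) j"
  have fin: "finite ?I"
    by (rule finite_subset[of _ "{..n} \<times> {..n}"]) auto
  have co: "coeff (coeff (?m x) j) i = (if x = (i, j) then 1 else 0)" for x i j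
    by (cases x) (auto simp: coeff_monom)
  have inj: "inj_on ?m ?I"
  proof (rule inj_onI)
    fix x y assume "?m x = ?m y"
    then have "coeff (coeff (?m x) (snd y)) (fst y) = 1" by (simp add: co)
    then show "x = y" by (simp add: co split: if_splits)
  qed
  have cosum: "coeff (coeff (\<Sum>x\<in>?I. scale2 (u x) (?m x)) j) i
      = (if (i, j) \<in> ?I then u (i, j) else 0)" for u i j
  proof -
    have "coeff (coeff (\<Sum>x\<in>?I. scale2 (u x) (?m x)) j) i
        = (\<Sum>x\<in>?I. u x * coeff (coeff (?m x) j) i)"
      by (simp add: coeff_sum scale2_def)
    also have "\<dots> = (\<Sum>x\<in>?I. if x = (i, j) then u x else 0)"
      by (rule sum.cong) (simp_all only: co, auto)
    also have "\<dots> = (if (i, j) \<in> ?I then u (i, j) else 0)"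
      using fin by (simp add: sum.delta)
    finally show ?thesis .
  qed
  have sub: "?m ` ?I \<subseteq> Pi_space n"
    by (force simp: Pi_space_def total_degree_le_iff coeff_monom split: if_splits)
  have span: "Pi_space n \<subseteq> poly2.span (?m ` ?I)"
  proof
    fix p assume p: "p \<in> Pi_space n"
    let ?q = "\<Sum>x\<in>?I. scale2 (coeff (coeff p (snd x)) (fst x)) (?m x)"
    have vanish: "coeff (coeff p j) i = 0" if "\<not> i + j \<le> n" for i j
      using p that unfolding Pi_space_def total_degree_le_iff by blast
    have "coeff (coeff p j) i = coeff (coeff ?q j) i" for i j
      unfolding cosum using vanish[of i j] by simp
    then have "p = ?q" by (intro poly_eqI)
    also have "\<dots> \<in> poly2.span (?m ` ?I)"
      by (intro poly2.span_sum poly2.span_scale poly2.span_base imageI)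
    finally show "p \<in> poly2.span (?m ` ?I)" .
  qed
  have ind: "poly2.independent (?m ` ?I)"
  proof (rule poly2.independent_if_scalars_zero)
    fix f x assume s: "(\<Sum>x\<in>?m ` ?I. scale2 (f x) x) = 0" and x: "x \<in> ?m ` ?I"
    have *: "(\<Sum>x\<in>?I. scale2 (f (?m x)) (?m x)) = 0"
      using s by (simp add: sum.reindex[OF inj] o_def)
    from x obtain i j where ij: "(i, j) \<in> ?I" "x = ?m (i, j)" by blast
    have "coeff (coeff (\<Sum>x\<in>?I. scale2 (f (?m x)) (?m x)) j) i = f (?m (i, j))"
      unfolding cosum using ij(1) by simp
    then show "f x = 0" using * ij(2) by simp
  qed (use fin in simp)
  have "N_dim n = card (?m ` ?I)"
    unfolding N_dim_def using poly2.dim_unique[OF sub span ind refl] .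
  then show ?thesis by (simp add: card_image[OF inj])
qed

lemma N_dim_eq: "N_dim n = (n + 1) * (n + 2) div 2"
proof -
  have "{(i, j). i + j \<le> n} = (SIGMA i:{..n}. {..n - i})" by auto
  then have "card {(i, j). i + j \<le> n} = (\<Sum>i\<le>n. Suc (n - i))" by simp
  also have "\<dots> = (\<Sum>i\<le>n. Suc i)"
    by (rule sum.reindex_bij_witness[of _ "\<lambda>i. n - i" "\<lambda>i. n - i"]) auto
  finally have *: "N_dim n = (\<Sum>i\<le>n. Suc i)" by (simp only: dim_Pi_space_card)
  have "2 * (\<Sum>i\<le>n. Suc i) = (n + 1) * (n + 2)"
  proof (induction n)
    case (Suc m)
    then show ?case by (simp only: sum.atMost_Suc distrib_left) simp
  qed simp
  then have "2 * N_dim n = (n + 1) * (n + 2)" by (simp only: *)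
  then show ?thesis by linarith
qed

lemma d_dim_eq: "k \<le> n \<Longrightarrow> d_dim n k = k * (2 * n + 3 - k) div 2"
proof -
  assume "k \<le> n"
  then obtain m where n: "n = m + k" by (metis le_add_diff_inverse2)
  have *: "2 * N_dim q = (q + 1) * (q + 2)" for q
    unfolding N_dim_eq by (rule dvd_mult_div_cancel) simp
  have "2 * N_dim n = 2 * N_dim m + k * (2 * n + 3 - k)"
    unfolding * n by (simp add: algebra_simps)
  then show ?thesis by (simp add: d_dim_def n)
qed

end

theory Submission
  imports Defs
begin

text \<open>
  Let \<open>V j\<close> be the space of the polynomials of degree at most \<open>j\<close> vanishing on \<open>X\<close>, and \<open>d j\<close> its
  dimension. If \<open>d j < d (j+1)\<close>, then \<open>d (j+2) + d j > 2 d (j+1)\<close>: since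
  \<open>y V (j+1) \<inter> V (j+1) = y V j\<close>, the space \<open>V (j+1) + y V (j+1)\<close> has dimension \<open>2 d (j+1) - d j\<close>,
  and it does not contain \<open>x u\<close> if \<open>u \<in> V (j+1)\<close> has a term of degree \<open>j+1\<close> with the largest
  exponent of \<open>x\<close> that occurs among such terms. So the increments of \<open>d\<close> increase strictly as soon as
  they are positive. If \<open>d k \<ge> 5\<close>, then \<open>d k - d (k-1) \<ge> 3\<close> (as \<open>1 + 2 < 5\<close>), hence
  \<open>d n \<ge> 5 + 4 + 5 + \<dots> + (n-k+3)\<close>, which exceeds the value \<open>N n - |X|\<close> of \<open>d n\<close> by one.
\<close>

section \<open>Independent sets whose spans meet only in 0\<close>

lemma (in vector_space) independent_Un:
  assumes "independent A" "independent B" "span A \<inter> span B \<subseteq> {0}"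
  shows "independent (A \<union> B)"
proof -
  \<comment> \<open>The sets are quantified here so that the argument also serves with their roles
    exchanged.\<close>
  have *: False
    if ind: "independent A" and 0: "span A \<inter> span B \<subseteq> {0}"
      and a: "a \<in> A" "a \<in> span (A \<union> B - {a})" for a A B
  proof -
    have "a \<in> span ((A - {a}) \<union> B)"
      using a(2) span_mono[of "A \<union> B - {a}" "(A - {a}) \<union> B"] by blast
    then obtain x y where xy: "a = x + y" "x \<in> span (A - {a})" "y \<in> span B"
      unfolding span_Un by blast
    have "x \<in> span A" using xy(2) span_mono[of "A - {a}" A] by blast
    then have "y \<in> span A" using xy(1) span_diff[OF span_base[OF a(1)]] by fastforce
    with xy 0 have "a \<in> span (A - {a})" by auto
    with ind a(1) show False by (auto simp: dependent_def)
  qed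
  show ?thesis
    unfolding dependent_def
    using *[OF assms(1,3)] *[OF assms(2), of A] assms(3) by (auto simp: Un_commute Int_commute)
qed

lemma (in vector_space) independent_spans_disjoint:
  assumes "independent A" "span A \<inter> span B \<subseteq> {0}"
  shows "A \<inter> B = {}"
proof (rule ccontr)
  assume "A \<inter> B \<noteq> {}"
  then obtain x where x: "x \<in> A" "x \<in> B" by blast
  then have "x \<in> span A \<inter> span B" by (simp add: span_base)
  then have "x = 0" using assms(2) by blast
  then show False using x(1) assms(1) dependent_zero by metis
qed

text \<open>The coordinates of \<open>z\<close> over \<open>A \<union> B\<close> are supported in
  \<open>A\<close> and also in \<open>B\<close>, hence nowhere.\<close>

lemma (in vector_space) span_Int_independent_disjoint:
  assumes "independent (A \<union> B)" "A \<inter> B = {}" "z \<in> span A" "z \<in> span B"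
  shows "z = 0"
proof -
  have "representation (A \<union> B) z = representation A z" "representation (A \<union> B) z = representation B z"
    using assms by (auto intro!: representation_extend)
  then have "representation A z b = 0" for b
    using assms(2) representation_ne_zero[of A z b] representation_ne_zero[of B z b] by auto
  moreover have "independent A" using assms(1) by (rule independent_mono) auto
  ultimately show ?thesis
    using sum_nonzero_representation_eq[of A z] assms(3) by simp
qed

section \<open>The spaces of polynomials vanishing on the nodes\<close>

lemma eval2_add: "eval2 (p + q) A = eval2 p A + eval2 q A"
  and eval2_scale2: "eval2 (scale2 c p) A = c * eval2 p A"
  and eval2_pCons_0: "eval2 (pCons 0 p) A = snd A * eval2 p A"
  and eval2_smult_X: "eval2 (smult [:0, 1:] p) A = fst A * eval2 p A"
  and eval2_0: "eval2 0 A = 0"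
  by (simp_all add: eval2_def scale2_def)

lemma coeff_scale2: "coeff (coeff (scale2 c p) j) i = c * coeff (coeff p j) i"
  by (simp add: scale2_def)

lemma coeff_smult_X: "coeff (coeff (smult [:0, 1:] p) j) i = (case i of 0 \<Rightarrow> 0 | Suc i' \<Rightarrow> coeff (coeff p j) i')"
  for p :: "real poly poly"
  by (simp add: coeff_pCons split: nat.split)

lemma eval2_sum: "eval2 (sum f S) A = (\<Sum>x\<in>S. eval2 (f x) A)"
  by (induction S rule: infinite_finite_induct) (simp_all add: eval2_add eval2_0)

lemma coeff2_eq_0: "total_degree p \<le> n \<Longrightarrow> n < i + j \<Longrightarrow> coeff (coeff p j) i = 0"
  using total_degree_le_iff[of p n] by fastforce

definition vanishing :: "(real \<times> real) set \<Rightarrow> nat \<Rightarrow> real poly poly set" where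
  "vanishing X n = {p \<in> Pi_space n. \<forall>A\<in>X. eval2 p A = 0}"

lemma subspace_vanishing: "poly2.subspace (vanishing X n)"
proof -
  have "total_degree (p + q) \<le> n" if "total_degree p \<le> n" "total_degree q \<le> n" for p q
    unfolding total_degree_le_iff using coeff2_eq_0[OF that(1)] coeff2_eq_0[OF that(2)]
    by (metis add.right_neutral coeff_add not_le_imp_less)
  moreover have "total_degree (scale2 c p) \<le> n" if "total_degree p \<le> n" for c p
    using that unfolding total_degree_le_iff by (simp add: coeff_scale2)
  moreover have "total_degree 0 \<le> n" by (simp add: total_degree_def)
  ultimately show ?thesis
    by (auto simp: vanishing_def Pi_space_def eval2_add eval2_scale2 eval2_0 intro!: poly2.subspaceI)
qed

lemma vanishing_mono: "vanishing X m \<subseteq> vanishing X n" if "m \<le> n"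
  using that by (auto simp: vanishing_def Pi_space_def)

lemma pCons_0_vanishing: "p \<in> vanishing X n \<Longrightarrow> pCons 0 p \<in> vanishing X (Suc n)"
  by (auto simp: vanishing_def Pi_space_def total_degree_le_iff eval2_pCons_0 coeff_pCons split: nat.splits)

lemma smult_X_vanishing: "p \<in> vanishing X n \<Longrightarrow> smult [:0, 1:] p \<in> vanishing X (Suc n)"
  unfolding vanishing_def Pi_space_def total_degree_le_iff
  by (simp only: coeff_smult_X mem_Collect_eq eval2_smult_X) (auto split: nat.splits)

text \<open>Dividing by y lowers the degree by one but may lose the zeros at nodes on the line y =
  0. Membership in \<open>vanishing X m\<close>, for whatever \<open>m\<close>, keeps them.\<close>

lemma pCons_0_vanishing_cancel:
  assumes "p \<in> vanishing X m" "pCons 0 p \<in> vanishing X (Suc n)"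
  shows "p \<in> vanishing X n"
proof -
  have "i + j \<le> n" if "coeff (coeff p j) i \<noteq> 0" for i j
  proof -
    have "coeff (coeff (pCons 0 p) (Suc j)) i \<noteq> 0" using that by simp
    then have "i + Suc j \<le> Suc n"
      using assms(2) unfolding vanishing_def Pi_space_def total_degree_le_iff by blast
    then show ?thesis by simp
  qed
  then show ?thesis
    using assms(1) by (auto simp: vanishing_def Pi_space_def total_degree_le_iff)
qed

section \<open>Dimension bounds\<close>

lemma Pi_space_independent_bound:
  assumes "poly2.independent S" "S \<subseteq> Pi_space n"
  shows "finite S" "card S \<le> N_dim n"
proof -
  obtain B where B: "Pi_space n \<subseteq> poly2.span B" "card B = N_dim n"
    unfolding N_dim_def by (rule poly2.basis_exists)
  \<comment> \<open>An infinite set has \<open>card\<close> 0, so a positive dimension makes the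
    basis finite.\<close>
  have "N_dim n > 0" by (simp add: N_dim_eq)
  with B have "finite B" using card_ge_0_finite by metis
  from poly2.independent_span_bound[OF this assms(1)] B assms(2)
  show "finite S" "card S \<le> N_dim n" by auto
qed

lemma vanishing_independent_bound:
  assumes "poly2.independent S" "S \<subseteq> vanishing X n"
  shows "finite S" "card S \<le> poly2.dim (vanishing X n)"
proof -
  obtain B where B: "B \<subseteq> vanishing X n" "poly2.independent B" "vanishing X n \<subseteq> poly2.span B"
    "card B = poly2.dim (vanishing X n)"
    by (rule poly2.basis_exists)
  from B have "finite B" using Pi_space_independent_bound(1)[of B n] by (auto simp: vanishing_def)
  from poly2.independent_span_bound[OF this assms(1)] B assms(2)
  show "finite S" "card S \<le> poly2.dim (vanishing X n)" by auto
qed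

lemma dim_vanishing_mono: "poly2.dim (vanishing X m) \<le> poly2.dim (vanishing X n)" if "m \<le> n"
  using vanishing_independent_bound(2)[of _ X n] vanishing_mono[OF that, of X]
  by (metis poly2.basis_exists subset_trans)

text \<open>A combination of fundamental polynomials has its coefficients as values at the nodes.
  Hence these polynomials are independent and their span meets \<open>vanishing X n\<close> only in
  0, so a basis of that space can be joined to them inside \<open>Pi_space n\<close>.\<close>

lemma dim_vanishing_n_independent:
  assumes "finite X" "n_independent n X"
  shows "poly2.dim (vanishing X n) + card X \<le> N_dim n"
proof -
  obtain B where B: "B \<subseteq> vanishing X n" "poly2.independent B" "vanishing X n \<subseteq> poly2.span B"
    "card B = poly2.dim (vanishing X n)"
    by (rule poly2.basis_exists)
  obtain f where f: "\<And>A. A \<in> X \<Longrightarrow> fundamental_poly n X A (f A)"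
    using assms(2) unfolding n_independent_def by metis
  have delta: "eval2 (f A) A' = (if A = A' then 1 else 0)" if "A \<in> X" "A' \<in> X" for A A'
    using f[OF that(1)] that by (auto simp: fundamental_poly_def)
  have inj: "inj_on f X"
  proof (rule inj_onI)
    fix A B assume AB: "A \<in> X" "B \<in> X" "f A = f B"
    have "eval2 (f B) A = 1" using delta[OF AB(1,1)] unfolding AB(3) by simp
    then show "A = B" unfolding delta[OF AB(2,1)] by (simp split: if_splits)
  qed
  have ev: "eval2 (\<Sum>p\<in>f ` X. scale2 (u p) p) A = u (f A)" if "A \<in> X" for u A
  proof -
    have "eval2 (\<Sum>p\<in>f ` X. scale2 (u p) p) A = (\<Sum>B\<in>X. u (f B) * eval2 (f B) A)"
      by (simp add: sum.reindex[OF inj] eval2_sum eval2_scale2)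
    also have "\<dots> = (\<Sum>B\<in>X. if B = A then u (f B) else 0)"
      by (rule sum.cong) (simp_all add: delta that)
    finally show ?thesis using that assms(1) by simp
  qed
  have "poly2.independent (f ` X)"
  proof (rule poly2.independent_if_scalars_zero)
    fix u p assume 0: "(\<Sum>p\<in>f ` X. scale2 (u p) p) = 0" and "p \<in> f ` X"
    then obtain A where "A \<in> X" "p = f A" by blast
    then show "u p = 0" using ev[of A u] 0 by (simp add: eval2_0)
  qed (use assms in simp)
  moreover have disj: "poly2.span B \<inter> poly2.span (f ` X) \<subseteq> {0}"
  proof
    fix p assume p: "p \<in> poly2.span B \<inter> poly2.span (f ` X)"
    then obtain u where u: "p = (\<Sum>p\<in>f ` X. scale2 (u p) p)"
      using poly2.span_finite[of "f ` X"] assms(1) by auto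
    have "p \<in> vanishing X n"
      using p poly2.span_minimal[OF B(1) subspace_vanishing] by auto
    then have "u (f A) = 0" if "A \<in> X" for A
      using ev[OF that, of u] that unfolding u vanishing_def by simp
    then have "p = 0" unfolding u by (intro sum.neutral) auto
    then show "p \<in> {0}" by simp
  qed
  ultimately have ind: "poly2.independent (B \<union> f ` X)"
    by (rule poly2.independent_Un[OF B(2)])
  have "B \<subseteq> Pi_space n" using B(1) unfolding vanishing_def by blast
  moreover have "f ` X \<subseteq> Pi_space n" using f unfolding fundamental_poly_def by blast
  ultimately have sub: "B \<union> f ` X \<subseteq> Pi_space n" by blast
  have "B \<inter> f ` X = {}" by (rule poly2.independent_spans_disjoint[OF B(2) disj])
  then have "card (B \<union> f ` X) = card B + card X"
    using Pi_space_independent_bound(1)[OF ind sub] by (simp add: card_Un_disjoint card_image[OF inj])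
  then show ?thesis
    using Pi_space_independent_bound(2)[OF ind sub] B(4) by simp
qed

lemma dim_vanishing_0:
  assumes "X \<noteq> {}"
  shows "poly2.dim (vanishing X 0) = 0"
proof -
  have "vanishing X 0 \<subseteq> poly2.span {}"
  proof
    fix p assume p: "p \<in> vanishing X 0"
    obtain a b where ab: "(a, b) \<in> X" using assms by auto
    have c: "coeff (coeff p j) i = 0" if "i \<noteq> 0 \<or> j \<noteq> 0" for i j
      using p that coeff2_eq_0[of p 0 i j] by (auto simp: vanishing_def Pi_space_def)
    have "p = [:[:coeff (coeff p 0) 0:]:]"
      by (intro poly_eqI) (use c in \<open>auto simp: coeff_pCons split: nat.split\<close>)
    then obtain c where pc: "p = [:[:c:]:]" by blast
    have "eval2 p (a, b) = 0" using p ab unfolding vanishing_def by blast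
    then have "p = 0" by (simp add: pc eval2_def)
    then show "p \<in> poly2.span {}" by simp
  qed
  then show ?thesis using poly2.dim_le_card[of _ "{}"] by fastforce
qed

section \<open>Strict convexity of the dimensions\<close>

lemma pCons_0_linear: "Vector_Spaces.linear scale2 scale2 (pCons 0)"
  by unfold_locales (simp_all add: scale2_def)

text \<open>With \<open>a\<close> the largest x-exponent in a term of degree n+1 of any member of
  \<open>vanishing X (Suc n)\<close>, and \<open>u\<close> a member attaining it, the monomial
  x^(a+1) y^(n+1-a) occurs in x u but neither in v nor in y w.\<close>

lemma exists_outside_vanishing_plus_pCons_0:
  assumes "\<not> vanishing X (Suc n) \<subseteq> vanishing X n"
  obtains u where "u \<in> vanishing X (Suc n)"
    "\<And>v w. v \<in> vanishing X (Suc n) \<Longrightarrow> w \<in> vanishing X (Suc n) \<Longrightarrow> smult [:0, 1:] u \<noteq> v + pCons 0 w"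
proof -
  let ?P = "\<lambda>a. a \<le> Suc n \<and> (\<exists>u \<in> vanishing X (Suc n). coeff (coeff u (Suc n - a)) a \<noteq> 0)"
  obtain p where p: "p \<in> vanishing X (Suc n)" "p \<notin> vanishing X n" using assms by blast
  then obtain i j where ij: "coeff (coeff p j) i \<noteq> 0" "\<not> i + j \<le> n"
    unfolding vanishing_def Pi_space_def total_degree_le_iff by blast
  moreover have "i + j \<le> Suc n"
    using p(1) ij(1) unfolding vanishing_def Pi_space_def total_degree_le_iff by blast
  ultimately have "i \<le> Suc n" "j = Suc n - i" by linarith+
  with p(1) ij(1) have "?P i" by blast
  then obtain a where a: "?P a" "\<And>b. ?P b \<Longrightarrow> b \<le> a"
    using GreatestI_nat[of ?P i "Suc n"] Greatest_le_nat[of ?P _ "Suc n"] by blast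
  then obtain u where u: "u \<in> vanishing X (Suc n)" "coeff (coeff u (Suc n - a)) a \<noteq> 0" by blast
  show ?thesis
  proof (rule that[OF u(1)])
    fix v w assume v: "v \<in> vanishing X (Suc n)" and w: "w \<in> vanishing X (Suc n)"
    \<comment> \<open>The monomial has degree n+2, too large for \<open>v\<close>.\<close>
    have "coeff (coeff v (Suc n - a)) (Suc a) = 0"
      using v a(1) by (auto simp: vanishing_def Pi_space_def intro: coeff2_eq_0)
    moreover have "coeff (coeff (pCons 0 w) (Suc n - a)) (Suc a) = 0"
    \<comment> \<open>Every term of y w contains y, which settles the case 0. Otherwise
      \<open>w\<close> would have the term x^(a+1) y^(n-a) of degree n+1, against the maximality of
      \<open>a\<close>.\<close>
    proof (cases "Suc n - a")
      case (Suc m)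
      then have m: "m = Suc n - Suc a" "Suc a \<le> Suc n" by simp_all
      have "coeff (coeff w m) (Suc a) = 0"
        using a(2)[of "Suc a"] m w by auto
      then show ?thesis by (simp add: Suc)
    qed simp
    moreover have "coeff (coeff (smult [:0, 1:] u) (Suc n - a)) (Suc a) \<noteq> 0"
      using u(2) by (simp only: coeff_smult_X) simp
    ultimately show "smult [:0, 1:] u \<noteq> v + pCons 0 w" by (metis coeff_add add_0)
  qed
qed

text \<open>A basis \<open>B\<close> of \<open>vanishing X n\<close> is extended by \<open>C\<close>
  to a basis \<open>D\<close> of \<open>vanishing X (Suc n)\<close>. Since y B already lies in the
  span of \<open>D\<close>, only y C is added, and then x u. These are d(n+1) + (d(n+1) - d(n)) + 1
  independent elements of the next space.\<close>

lemma dim_vanishing_convex: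
  assumes lt: "poly2.dim (vanishing X n) < poly2.dim (vanishing X (Suc n))"
  shows "2 * poly2.dim (vanishing X (Suc n)) < poly2.dim (vanishing X (Suc (Suc n))) + poly2.dim (vanishing X n)"
proof -
  interpret y: Vector_Spaces.linear scale2 scale2 "pCons 0" by (rule pCons_0_linear)
  obtain B where B: "B \<subseteq> vanishing X n" "poly2.independent B" "vanishing X n \<subseteq> poly2.span B"
    "card B = poly2.dim (vanishing X n)"
    by (rule poly2.basis_exists)
  have "B \<subseteq> vanishing X (Suc n)" using B(1) vanishing_mono[of n "Suc n" X] by auto
  then obtain D where D: "B \<subseteq> D" "D \<subseteq> vanishing X (Suc n)" "poly2.independent D"
    "vanishing X (Suc n) \<subseteq> poly2.span D"
    using poly2.maximal_independent_subset_extend[OF _ B(2)] by blast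
  have cardD: "card D = poly2.dim (vanishing X (Suc n))" using D by (intro poly2.basis_card_eq_dim)
  have finD: "finite D" using D vanishing_independent_bound(1) by blast
  have spanD: "poly2.span D = vanishing X (Suc n)"
    using D poly2.span_minimal[OF D(2) subspace_vanishing] by blast
  define C where "C = D - B"
  have C: "C \<subseteq> D" "B \<union> C = D" "B \<inter> C = {}" "finite C" using D(1) finD by (auto simp: C_def)
  have cardC: "card C + card B = card D" 
    using C card_Un_disjoint[of B C] finD D(1) finite_subset by auto
  have "poly2.independent C" using poly2.independent_mono[OF D(3) C(1)] .
  then have yC: "poly2.independent (pCons 0 ` C)"
    by (rule y.independent_injective_image) (simp add: inj_on_def)
  have spanC: "poly2.span C \<subseteq> vanishing X (Suc n)" using poly2.span_mono[OF C(1)] spanD by auto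
  have disj: "poly2.span D \<inter> poly2.span (pCons 0 ` C) \<subseteq> {0}"
  proof
    fix p assume p: "p \<in> poly2.span D \<inter> poly2.span (pCons 0 ` C)"
    then obtain c where c: "c \<in> poly2.span C" "p = pCons 0 c" by (auto simp: y.span_image)
    \<comment> \<open>As y c has degree at most n+1, \<open>c\<close> lies in the span of
      \<open>B\<close> as well as in that of \<open>C\<close>.\<close>
    have "c \<in> vanishing X n"
      using c p spanC spanD by (auto intro: pCons_0_vanishing_cancel)
    then have "c = 0"
      using B(3) c(1) C D(3) by (auto intro: poly2.span_Int_independent_disjoint[of B C])
    then show "p \<in> {0}" using c by simp
  qed
  have ind: "poly2.independent (D \<union> pCons 0 ` C)" by (rule poly2.independent_Un[OF D(3) yC disj])
  have "D \<inter> pCons 0 ` C = {}" by (rule poly2.independent_spans_disjoint[OF D(3) disj])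
  then have card: "card (D \<union> pCons 0 ` C) = card D + card C"
    using finD C(4) by (simp add: card_Un_disjoint card_image inj_on_def)
  have "\<not> vanishing X (Suc n) \<subseteq> vanishing X n"
    using lt vanishing_mono[of n "Suc n" X] by auto
  then obtain u where u: "u \<in> vanishing X (Suc n)"
    "\<And>v w. v \<in> vanishing X (Suc n) \<Longrightarrow> w \<in> vanishing X (Suc n) \<Longrightarrow> smult [:0, 1:] u \<noteq> v + pCons 0 w"
    using exists_outside_vanishing_plus_pCons_0 by blast
  let ?E = "insert (smult [:0, 1:] u) (D \<union> pCons 0 ` C)"
  have out: "smult [:0, 1:] u \<notin> poly2.span (D \<union> pCons 0 ` C)"
    unfolding poly2.span_Un y.span_image spanD using u(2) spanC by fastforce
  then have indE: "poly2.independent ?E" using ind by (rule poly2.independent_insertI)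
  have "?E \<subseteq> vanishing X (Suc (Suc n))"
    using smult_X_vanishing[OF u(1)] D(2) C(1) vanishing_mono[of "Suc n" "Suc (Suc n)" X]
    by (auto intro: pCons_0_vanishing)
  from vanishing_independent_bound(2)[OF indE this]
  have "card ?E \<le> poly2.dim (vanishing X (Suc (Suc n)))" .
  moreover have "card ?E = Suc (card D + card C)"
    using out poly2.span_base finD C(4) card by (subst card_insert_disjoint) auto
  ultimately show ?thesis using cardC cardD B(4) by linarith
qed

section \<open>Sequences of naturals with strictly growing increments\<close>

context
  fixes d :: "nat \<Rightarrow> nat"
  assumes d_Suc: "d j \<le> d (Suc j)"
    and d_convex: "d j < d (Suc j) \<Longrightarrow> 2 * d (Suc j) < d (Suc (Suc j)) + d j"
begin

text \<open>Going back from \<open>e\<close>, the increments drop by at least one per step until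
  they are 0, so their sum is at most e + (e-1) + ... + 1.\<close>

lemma upper_bound_by_increment:
  assumes "d 0 = 0"
  shows "d (Suc j) = d j + e \<Longrightarrow> 2 * d (Suc j) \<le> e * (e + 1)"
proof (induction j arbitrary: e)
  case 0
  then show ?case using assms by (cases e) simp_all
next
  case (Suc j)
  obtain e' where e': "d (Suc j) = d j + e'" using d_Suc[of j] le_Suc_ex by blast
  note IH = Suc.IH[OF e']
  show ?case
  proof (cases "e' = 0")
    \<comment> \<open>A zero increment forces \<open>d (Suc j) = 0\<close> by the induction
      hypothesis, so the whole value is the last increment \<open>e\<close>.\<close>
    case True
    with IH have "d (Suc j) = 0" by simp
    then show ?thesis using Suc.prems by (cases e) simp_all
  next
    case False
    then have "e' < e" using d_convex[of j] e' Suc.prems by linarith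
    then obtain f where f: "e = Suc f" "e' \<le> f" by (cases e) auto
    have "e' * (e' + 1) \<le> f * (f + 1)" using f(2) by (intro mult_le_mono) auto
    with IH have "2 * d (Suc j) \<le> f * (f + 1)" by linarith
    then show ?thesis using Suc.prems f(1) by (simp add: algebra_simps)
  qed
qed

text \<open>The sum 5 + 4 + 5 + ... + (m+3) equals (m+3)(m+4)/2 - 1. The first conjunct, on
  increments, carries the induction.\<close>

lemma lower_bound_by_increment:
  assumes "d (Suc j) \<ge> d j + 3" "d (Suc j) \<ge> 5"
  shows "d (Suc (j + m)) \<ge> d (j + m) + m + 3 \<and> 2 * d (Suc (j + m)) + 2 \<ge> (m + 3) * (m + 4)"
proof (induction m)
  case (Suc m)
  then have "d (Suc (j + Suc m)) \<ge> d (j + Suc m) + Suc m + 3"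
    using d_convex[of "j + m"] by simp
  with Suc show ?case by (simp add: algebra_simps)
qed (use assms in simp)

end

theorem mainTheorem2:
  fixes n k :: nat and X :: "(real \<times> real) set"
  assumes "3 \<le> k" and "k \<le> n - 1"
    and "finite X" and "n_independent n X"
    and "card X = d_dim n (k - 2) + 2"
  shows "\<forall>C :: real poly poly set.
           (\<forall>p\<in>C. is_curve p \<and> total_degree p \<le> k \<and> (\<forall>A\<in>X. passes_through p A)) \<and>
           poly2.independent C \<longrightarrow> finite C \<and> card C \<le> 4"
proof -
  define d where "d j = poly2.dim (vanishing X j)" for j
  have mono: "d j \<le> d (Suc j)" for j
    by (simp add: d_def dim_vanishing_mono)
  have convex: "2 * d (Suc j) < d (Suc (Suc j)) + d j" if "d j < d (Suc j)" for j
    using that unfolding d_def by (rule dim_vanishing_convex)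
  have "X \<noteq> {}" using assms(5) by auto
  then have d0: "d 0 = 0" by (simp add: d_def dim_vanishing_0)
  obtain j where j: "k = Suc j" using assms(1) by (cases k) auto
  obtain m where m: "n = k + m" using assms(2) le_Suc_ex[of k n] by (metis diff_le_self le_trans)
  have dk: "d k \<le> 4"
  proof (rule ccontr)
    assume "\<not> d k \<le> 4"
    then have 5: "d (Suc j) \<ge> 5" by (simp add: j)
    obtain e where e: "d (Suc j) = d j + e" using mono[of j] le_Suc_ex by blast
    have "e \<ge> 3"
    proof (rule ccontr)
      assume "\<not> e \<ge> 3"
      \<comment> \<open>An increment of at most 2 would give d(k) <= 2 + 1 = 3.\<close>
      then have "e * (e + 1) \<le> 2 * 3" by (intro mult_le_mono) auto
      then show False using upper_bound_by_increment[of d, OF mono convex d0 e] 5 by linarith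
    qed
    then have "(m + 3) * (m + 4) \<le> 2 * d n + 2"
      using lower_bound_by_increment[of d, OF mono convex, of j m] 5 e by (simp add: j m)
    moreover have N: "2 * N_dim q = (q + 1) * (q + 2)" for q
      unfolding N_dim_eq by (rule dvd_mult_div_cancel) simp
    have "d n + card X \<le> N_dim n"
      unfolding d_def by (rule dim_vanishing_n_independent[OF assms(3,4)])
    \<comment> \<open>By the size of \<open>X\<close>, d(n) is at most N(m+2) - 2 = (m+3)(m+4)/2 -
      2, one less than the lower bound just found.\<close>
    then have "d n + 2 \<le> N_dim (n - (k - 2))"
      using assms(5) by (simp add: d_dim_def)
    moreover have "n - (k - 2) = m + 2" using m assms(1) by simp
    ultimately show False using N[of "m + 2"] by (simp add: algebra_simps)
  qed
  show ?thesis
  proof (intro allI impI)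
    fix C :: "real poly poly set"
    assume C: "(\<forall>p\<in>C. is_curve p \<and> total_degree p \<le> k \<and> (\<forall>A\<in>X. passes_through p A)) \<and>
           poly2.independent C"
    then have "C \<subseteq> vanishing X k"
      by (auto simp: vanishing_def Pi_space_def passes_through_def)
    then show "finite C \<and> card C \<le> 4"
      using C vanishing_independent_bound[of C X k] dk by (auto simp: d_def)
  qed
qed

end
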